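(* Let $\chi\in\mathcal C_n$ be a complete simple game with consensus, given as the intersection of the weighted voting games $[q;w_1,\dots,w_n]$ and $[q';1,\dots,1]$. Then $\mu(\chi)\le\sqrt n$.
   Context: Let $N=\{1,\dots,n\}$. A simple game on $n$ voters is a function $\chi:2^N\to\{0,1\}$ with $\chi(\emptyset)=0$, $\chi(N)=1$ and $\chi(S)\le\chi(T)$ whenever $S\subseteq T\subseteq N$. A coalition $S$ is winning if $\chi(S)=1$ and losing if $\chi(S)=0$. For voters $i,j\in N$ write $i\sqsupset j$ if $\chi(\{i\}\cup S\setminus\{j\})\ge\chi(S)$ for all $S$ with $j\in S\subseteq N\setminus\{i\}$. The simple game is complete if $\sqsupset$ is a total preorder on $N$; $\mathcal C_n$ is the set of complete simple games on $n$ voters. For real weights write $w(S)=\sum_{i\in S}w_i$. The weighted voting game $[q;w_1,\dots,w_n]$ with quota $q>0$ is the simple game in which $S$ is winning if and only if $w(S)\ge q$. The intersection of two games is the game in which a coalition is winning if and only if it is winning in both. For real $\alpha\ge 1$, $\chi$ is $\alpha$-roughly weighted if there are weights $v_1,\dots,v_n\in\mathbb R$ with $v(S)\ge 1$ for all winning $S$ and $v(S)\le\alpha$ for all losing $S$, where $v(S)=\sum_{i\in S}v_i$. The critical threshold value $\mu(\chi)$ is the smallest $\alpha\ge 1$ such that $\chi$ is $\alpha$-roughly weighted. *)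

theory Defs
  imports Complex_Main
begin

abbreviation voters :: "nat \<Rightarrow> nat set" where
  "voters n \<equiv> {1..n}"

text \<open>Only the values of a game on subsets of \<open>voters n\<close> matter; the values elsewhere are
  unconstrained and no definition below refers to them.\<close>

definition simple_game :: "nat \<Rightarrow> (nat set \<Rightarrow> nat) \<Rightarrow> bool" where
  "simple_game n \<chi> \<longleftrightarrow>
     (\<forall>S \<subseteq> voters n. \<chi> S \<in> {0, 1}) \<and> \<chi> {} = 0 \<and> \<chi> (voters n) = 1 \<and>
     (\<forall>S T. S \<subseteq> T \<and> T \<subseteq> voters n \<longrightarrow> \<chi> S \<le> \<chi> T)"

definition winning :: "(nat set \<Rightarrow> nat) \<Rightarrow> nat set \<Rightarrow> bool" where
  "winning \<chi> S \<longleftrightarrow> \<chi> S = 1"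

definition losing :: "(nat set \<Rightarrow> nat) \<Rightarrow> nat set \<Rightarrow> bool" where
  "losing \<chi> S \<longleftrightarrow> \<chi> S = 0"

definition desirability :: "nat \<Rightarrow> (nat set \<Rightarrow> nat) \<Rightarrow> (nat \<times> nat) set" where
  "desirability n \<chi> =
     {(i, j). i \<in> voters n \<and> j \<in> voters n \<and>
        (\<forall>S. j \<in> S \<and> S \<subseteq> voters n - {i} \<longrightarrow> \<chi> ({i} \<union> S - {j}) \<ge> \<chi> S)}"

definition complete_simple_games :: "nat \<Rightarrow> (nat set \<Rightarrow> nat) set" where
  "complete_simple_games n =
     {\<chi>. simple_game n \<chi> \<and> preorder_on (voters n) (desirability n \<chi>) \<and>
         total_on (voters n) (desirability n \<chi>)}"

definition threshold_game :: "real \<Rightarrow> (nat \<Rightarrow> real) \<Rightarrow> nat set \<Rightarrow> nat" where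
  "threshold_game q w S = (if sum w S \<ge> q then 1 else 0)"

text \<open>Weights may be negative, as long as the threshold rule still yields a simple game.\<close>

definition weighted_voting_game :: "nat \<Rightarrow> real \<Rightarrow> (nat \<Rightarrow> real) \<Rightarrow> bool" where
  "weighted_voting_game n q w \<longleftrightarrow> q > 0 \<and> simple_game n (threshold_game q w)"

definition game_inter :: "(nat set \<Rightarrow> nat) \<Rightarrow> (nat set \<Rightarrow> nat) \<Rightarrow> nat set \<Rightarrow> nat" where
  "game_inter \<chi> \<chi>' S = (if winning \<chi> S \<and> winning \<chi>' S then 1 else 0)"

definition roughly_weighted :: "nat \<Rightarrow> real \<Rightarrow> (nat set \<Rightarrow> nat) \<Rightarrow> bool" where
  "roughly_weighted n \<alpha> \<chi> \<longleftrightarrow>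
     (\<exists>v :: nat \<Rightarrow> real. \<forall>S \<subseteq> voters n.
        (winning \<chi> S \<longrightarrow> sum v S \<ge> 1) \<and> (losing \<chi> S \<longrightarrow> sum v S \<le> \<alpha>))"

text \<open>For a simple game the least element exists: replacing each \<open>v i\<close> by
  \<open>max 0 (min 1 (v i))\<close> preserves \<open>\<alpha>\<close>-rough weightedness for \<open>\<alpha> \<ge> 1\<close>, so the minimum may be
  taken over a compact set of weights.\<close>

definition critical_threshold :: "nat \<Rightarrow> (nat set \<Rightarrow> nat) \<Rightarrow> real" where
  "critical_threshold n \<chi> = (LEAST \<alpha>. \<alpha> \<ge> 1 \<and> roughly_weighted n \<alpha> \<chi>)"

end

theory Submission
  imports Defs "HOL-Analysis.Function_Topology"
begin

text \<open>The easy bounds on the two component games balance each other at quota \<open>sqrt n\<close>. If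
  \<open>q' \<le> sqrt n\<close>, truncate \<open>w / q\<close> to weights in \<open>[0, 1]\<close>; a coalition losing
  only because of its size then has weight at most its size, which is below \<open>q'\<close>. If
  \<open>q' > sqrt n\<close>, give each voter weight \<open>1 / q'\<close>; then no coalition weighs more than \<open>n / q'\<close>.\<close>

lemma losing_subset:
  assumes "simple_game n \<chi>" "losing \<chi> T" "S \<subseteq> T" "T \<subseteq> voters n"
  shows "losing \<chi> S"
  using assms unfolding simple_game_def losing_def by (metis le_zero_eq)

text \<open>Clipping \<open>v\<close> to the unit interval keeps both bounds, thanks to monotonicity
  of the game. The lower bound 0 and the upper bound 1 make the set of weights compact; the upper
  bound also limits the weight of a coalition by its size.\<close>

lemma roughly_weighted_unit_interval:
  assumes "simple_game n \<chi>" "roughly_weighted n \<alpha> \<chi>"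
  obtains u where "\<And>i. 0 \<le> u i" "\<And>i. u i \<le> 1"
    "\<And>S. S \<subseteq> voters n \<Longrightarrow> winning \<chi> S \<Longrightarrow> 1 \<le> sum u S"
    "\<And>S. S \<subseteq> voters n \<Longrightarrow> losing \<chi> S \<Longrightarrow> sum u S \<le> \<alpha>"
proof -
  obtain v :: "nat \<Rightarrow> real" where
    win: "\<And>S. S \<subseteq> voters n \<Longrightarrow> winning \<chi> S \<Longrightarrow> 1 \<le> sum v S" and
    lose: "\<And>S. S \<subseteq> voters n \<Longrightarrow> losing \<chi> S \<Longrightarrow> sum v S \<le> \<alpha>"
    using assms(2) unfolding roughly_weighted_def by auto
  define u where "u i = max 0 (min 1 (v i))" for i
  have "1 \<le> sum u S" if "S \<subseteq> voters n" "winning \<chi> S" for S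
  \<comment> \<open>A member with weight at least 1 is clipped to exactly 1 and suffices alone;
    without such a member clipping can only raise weights.\<close>
  proof (cases "\<exists>i\<in>S. 1 \<le> v i")
    case True
    then obtain i where "i \<in> S" "1 \<le> v i" by blast
    moreover have "finite S" using that(1) finite_subset by blast
    moreover have "u i \<le> sum u S"
      using calculation by (intro member_le_sum) (auto simp: u_def)
    ultimately show ?thesis by (simp add: u_def)
  next
    case False
    then have "sum v S \<le> sum u S"
      by (intro sum_mono) (auto simp: u_def)
    with win[OF that] show ?thesis by linarith
  qed
  moreover have "sum u S \<le> \<alpha>" if "S \<subseteq> voters n" "losing \<chi> S" for S
  proof -
    \<comment> \<open>Clipping raises negative weights, so \<open>v\<close> is compared with
      \<open>u\<close> only on \<open>P\<close>, where clipping never raises; as a subset of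
      \<open>S\<close>, \<open>P\<close> is losing too.\<close>
    define P where "P = {i \<in> S. 0 \<le> v i}"
    have fin: "finite S" using that(1) finite_subset by blast
    have "sum u S = sum u P"
      using fin by (intro sum.mono_neutral_right) (auto simp: P_def u_def)
    also have "\<dots> \<le> sum v P"
      by (intro sum_mono) (auto simp: P_def u_def)
    also have "\<dots> \<le> \<alpha>"
      using that losing_subset[OF assms(1) that(2), of P] by (intro lose) (auto simp: P_def)
    finally show ?thesis .
  qed
  ultimately show thesis
    by (intro that[of u]) (auto simp: u_def)
qed

text \<open>\<open>LEAST\<close> over the reals says something only once a minimum is known to
  exist. It comes from compactness: \<open>snd\<close> attains its infimum on the set
  \<open>K\<close> of pairs of clipped weights and thresholds.\<close>

lemma critical_threshold_le:
  assumes "simple_game n \<chi>" "1 \<le> \<alpha>" "roughly_weighted n \<alpha> \<chi>"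
  shows "critical_threshold n \<chi> \<le> \<alpha>"
proof -
  \<comment> \<open>Capping thresholds at \<open>\<alpha>\<close> makes the second factor compact;
    larger thresholds cannot be minimal, since \<open>\<alpha>\<close> itself is admissible.\<close>
  define K :: "((nat \<Rightarrow> real) \<times> real) set" where
    "K = (Pi UNIV (\<lambda>_. {0..1}) \<times> {1..\<alpha>}) \<inter>
       ((\<Inter>S\<in>{S. S \<subseteq> voters n \<and> winning \<chi> S}. {p. 1 \<le> sum (fst p) S}) \<inter>
        (\<Inter>S\<in>{S. S \<subseteq> voters n \<and> losing \<chi> S}. {p. sum (fst p) S \<le> snd p}))"
  have in_K: "\<exists>u. (u, \<beta>) \<in> K" if \<beta>: "1 \<le> \<beta>" "\<beta> \<le> \<alpha>" "roughly_weighted n \<beta> \<chi>" for \<beta>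
  proof -
    obtain u :: "nat \<Rightarrow> real" where u: "\<And>i. 0 \<le> u i" "\<And>i. u i \<le> 1"
      "\<And>S. S \<subseteq> voters n \<Longrightarrow> winning \<chi> S \<Longrightarrow> 1 \<le> sum u S"
      "\<And>S. S \<subseteq> voters n \<Longrightarrow> losing \<chi> S \<Longrightarrow> sum u S \<le> \<beta>"
      using roughly_weighted_unit_interval[OF assms(1) \<beta>(3)] by blast
    have "(u, \<beta>) \<in> K"
      unfolding K_def using u \<beta>(1,2) by (simp add: Pi_iff)
    then show ?thesis by blast
  qed
  have coord: "continuous_on UNIV (\<lambda>p::(nat \<Rightarrow> real) \<times> real. fst p i)" for i
    by (rule continuous_on_product_then_coordinatewise[OF continuous_on_fst[OF continuous_on_id]])
  \<comment> \<open>Tychonoff: weights are functions on all of \<open>nat\<close>, so the cube is an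
    infinite product.\<close>
  have "compactin (product_topology (\<lambda>_. euclidean) UNIV)
          (PiE UNIV (\<lambda>_::nat. {0..1::real}))"
    by (subst compactin_PiE) auto
  then have "compact (Pi UNIV (\<lambda>_::nat. {0..1::real}))"
    by (simp add: euclidean_product_topology PiE_UNIV_domain)
  then have "compact (Pi UNIV (\<lambda>_::nat. {0..1::real}) \<times> {1..\<alpha>})"
    by (rule compact_Times[OF _ compact_Icc])
  moreover have "closed {p::(nat \<Rightarrow> real) \<times> real. 1 \<le> sum (fst p) S}"
    "closed {p::(nat \<Rightarrow> real) \<times> real. sum (fst p) S \<le> snd p}" for S
    by (rule closed_Collect_le continuous_on_const continuous_on_sum coord
          continuous_on_snd[OF continuous_on_id])+
  ultimately have "compact K"
    unfolding K_def by (intro compact_Int_closed closed_Int closed_INT ballI)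
  moreover have "K \<noteq> {}"
    using in_K[OF assms(2) order_refl assms(3)] by blast
  moreover have "continuous_on K snd"
    by (rule continuous_on_snd[OF continuous_on_id])
  ultimately have "\<exists>p\<in>K. \<forall>p'\<in>K. snd p \<le> snd p'"
    by (rule continuous_attains_inf)
  then obtain v \<mu> where v: "(v, \<mu>) \<in> K" and least: "\<And>p. p \<in> K \<Longrightarrow> \<mu> \<le> snd p"
    by (metis prod.collapse)
  have \<mu>: "1 \<le> \<mu>" "\<mu> \<le> \<alpha>"
    using v by (simp_all add: K_def)
  have "winning \<chi> S \<Longrightarrow> 1 \<le> sum v S" "losing \<chi> S \<Longrightarrow> sum v S \<le> \<mu>"
    if "S \<subseteq> voters n" for S
    using v that by (simp_all add: K_def)
  then have "roughly_weighted n \<mu> \<chi>"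
    unfolding roughly_weighted_def by (intro exI[of _ v] allI impI conjI)
  have "critical_threshold n \<chi> = \<mu>"
    unfolding critical_threshold_def
  proof (rule Least_equality)
    show "1 \<le> \<mu> \<and> roughly_weighted n \<mu> \<chi>"
      using \<mu>(1) \<open>roughly_weighted n \<mu> \<chi>\<close> by blast
    show "\<mu> \<le> \<beta>" if \<beta>: "1 \<le> \<beta> \<and> roughly_weighted n \<beta> \<chi>" for \<beta>
    proof (cases "\<beta> \<le> \<alpha>")
      case True
      then obtain u where "(u, \<beta>) \<in> K"
        using in_K \<beta> by blast
      then show ?thesis
        using least[of "(u, \<beta>)"] by simp
    next
      case False
      with \<mu>(2) show ?thesis by linarith
    qed
  qed
  with \<mu>(2) show ?thesis by simp
qed

theorem lemma11:
  fixes n :: nat and \<chi> :: "nat set \<Rightarrow> nat" and q q' :: real and w :: "nat \<Rightarrow> real"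
  assumes "\<chi> \<in> complete_simple_games n"
    and "weighted_voting_game n q w"
    and "weighted_voting_game n q' (\<lambda>_. 1)"
    and "\<forall>S \<subseteq> voters n. \<chi> S = game_inter (threshold_game q w) (threshold_game q' (\<lambda>_. 1)) S"
  shows "critical_threshold n \<chi> \<le> sqrt (real n)"
proof -
  have \<chi>: "simple_game n \<chi>"
    using assms(1) by (simp add: complete_simple_games_def)
  have q: "0 < q" "simple_game n (threshold_game q w)" and q': "0 < q'"
    using assms(2,3) by (auto simp: weighted_voting_game_def)
  have winning_iff: "winning \<chi> S \<longleftrightarrow> q \<le> sum w S \<and> q' \<le> real (card S)"
    and losing_iff: "losing \<chi> S \<longleftrightarrow> sum w S < q \<or> real (card S) < q'"
    if "S \<subseteq> voters n" for S
    using assms(4) that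
    by (auto simp: winning_def losing_def game_inter_def threshold_game_def)
  have card_le: "card S \<le> n" if "S \<subseteq> voters n" for S
    using card_mono[OF _ that] by simp
  \<comment> \<open>For \<open>n = 0\<close> the empty and the full coalition would
    coincide.\<close>
  have "n \<noteq> 0"
    using \<chi> by (intro notI) (auto simp: simple_game_def)
  then have n: "1 \<le> sqrt (real n)" by simp
  have "roughly_weighted n (sqrt (real n)) \<chi>"
  proof (cases "q' \<le> sqrt (real n)")
    case True
    \<comment> \<open>Dividing by \<open>q\<close> moves the quota to 1. The clipping below is done
      relative to this component game rather than \<open>\<chi>\<close>, as coalitions losing in
      \<open>\<chi>\<close> may have large \<open>w\<close>-weight.\<close>
    have "roughly_weighted n 1 (threshold_game q w)"
      unfolding roughly_weighted_def
      by (rule exI[of _ "\<lambda>i. w i / q"])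
         (use q(1) in \<open>auto simp: winning_def losing_def threshold_game_def
            simp flip: sum_divide_distrib split: if_splits\<close>)
    then obtain u :: "nat \<Rightarrow> real" where u: "\<And>i. 0 \<le> u i" "\<And>i. u i \<le> 1"
      "\<And>S. S \<subseteq> voters n \<Longrightarrow> winning (threshold_game q w) S \<Longrightarrow> 1 \<le> sum u S"
      "\<And>S. S \<subseteq> voters n \<Longrightarrow> losing (threshold_game q w) S \<Longrightarrow> sum u S \<le> 1"
      using roughly_weighted_unit_interval[OF q(2)] by blast
    have "1 \<le> sum u S" if "S \<subseteq> voters n" "winning \<chi> S" for S
      using u(3) winning_iff that by (simp add: winning_def threshold_game_def)
    moreover have "sum u S \<le> sqrt (real n)" if "S \<subseteq> voters n" "losing \<chi> S" for S
    proof (cases "sum w S < q")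
      case True
      then have "sum u S \<le> 1"
        using u(4) that(1) by (simp add: losing_def threshold_game_def)
      with n show ?thesis by linarith
    next
      \<comment> \<open>Here \<open>S\<close> loses by size alone, so
        \<open>sum u S \<le> card S < q' \<le> sqrt n\<close>.\<close>
      case False
      have "sum u S \<le> real (card S)"
        using sum_bounded_above[of S u 1] u(2) by simp
      with False \<open>q' \<le> sqrt (real n)\<close> losing_iff that show ?thesis by fastforce
    qed
    ultimately show ?thesis
      unfolding roughly_weighted_def by blast
  next
    case False
    \<comment> \<open>This bound holds for every coalition, since
      \<open>card S \<le> n = sqrt n * sqrt n\<close> and \<open>sqrt n < q'\<close>.\<close>
    have "real (card S) / q' \<le> sqrt (real n)" if "S \<subseteq> voters n" for S
    proof -
      have "real (card S) \<le> sqrt (real n) * sqrt (real n)"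
        using card_le[OF that] by simp
      also have "\<dots> \<le> sqrt (real n) * q'"
        using False by (intro mult_left_mono) auto
      finally show ?thesis
        using q' by (simp add: divide_le_eq)
    qed
    then show ?thesis
      unfolding roughly_weighted_def
      by (intro exI[of _ "\<lambda>_. 1 / q'"]) (use q' winning_iff in auto)
  qed
  then show ?thesis
    using critical_threshold_le[OF \<chi> n] by simp
qed

end
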